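(* Let $\eta=(\omega,t)$ and $\eta'=(\omega',t')$ be points of $\Omega^*$, where $\omega,\omega'\in\mathbb{N}^*$ and $t,t'\in[0,1]$. Then $\nu_{\eta}$ and $\nu_{\eta'}$ are singular if and only if $o(\omega)\cap o(\omega')=\emptyset$, i.e., $\omega'\notin o(\omega)$.
   Context: $\mathbb{N}=\{1,2,3,\dots\}$, $\beta\mathbb{N}$ is its Stone–Čech compactification and $\mathbb{N}^*=\beta\mathbb{N}\setminus\mathbb{N}$, whose points are the free ultrafilters on $\mathbb{N}$. Let $\tau:\beta\mathbb{N}\to\beta\mathbb{N}$ be the continuous extension of $n\mapsto n+1$; its restriction to $\mathbb{N}^*$ is a homeomorphism of $\mathbb{N}^*$ onto itself. For $\omega\in\mathbb{N}^*$ put $o(\omega)=\{\tau^n\omega: n\in\mathbb{Z}\}$. $\Omega^*$ is the quotient space of $\mathbb{N}^*\times[0,1]$ obtained by identifying $(\omega,1)$ with $(\tau\omega,0)$ for all $\omega\in\mathbb{N}^*$. For $\eta=(\omega,t)\in\Omega^*$, with $\theta=2^t$, $\nu_\eta$ is the finitely additive probability measure on $\mathcal{P}(\mathbb{N})$ given by $\nu_\eta(A)=\omega\text{-}\lim_n \frac{|A\cap\{1,\dots,[\theta\cdot 2^n]\}|}{\theta\cdot 2^n}$, the limit being taken along the ultrafilter $\omega$, where $[x]$ is the largest integer not exceeding $x$. Finitely additive probability measures $\mu,\nu$ on $\mathcal{P}(\mathbb{N})$ are singular if for every $\varepsilon>0$ there is $D\in\mathcal{P}(\mathbb{N})$ with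 $\mu(D)<\varepsilon$ and $\nu(D^c)<\varepsilon$. *)

theory Defs
  imports "HOL-Analysis.Analysis"
begin

section \<open>The positive integers and their Stone-Cech compactification\<close>

definition Npos :: "nat set" where
  "Npos = {1..}"

text \<open>
  Ultrafilters on \<open>Npos\<close> are represented as library filters on \<^typ>\<open>nat\<close> that contain \<open>Npos\<close>;
  a set \<open>A\<close> belongs to the ultrafilter \<open>F\<close> iff \<open>eventually (\<lambda>n. n \<in> A) F\<close>.
  The point \<open>n\<close> of \<open>Npos\<close> is embedded as \<open>principal {n}\<close>.
\<close>

definition ultrafilters :: "nat filter set" where
  "ultrafilters = {F. F \<noteq> bot \<and> eventually (\<lambda>n. n \<in> Npos) F \<and>
     (\<forall>A\<subseteq>Npos. eventually (\<lambda>n. n \<in> A) F \<or> eventually (\<lambda>n. n \<in> Npos - A) F)}"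

definition basic_open :: "nat set \<Rightarrow> nat filter set" where
  "basic_open A = {F \<in> ultrafilters. eventually (\<lambda>n. n \<in> A) F}"

definition betaN :: "nat filter topology" where
  "betaN = topology_generated_by (basic_open ` Pow Npos)"

definition Nstar :: "nat filter set" where
  "Nstar = topspace betaN - (\<lambda>n. principal {n}) ` Npos"

text \<open>
  The continuous extension of \<open>n \<mapsto> n + 1\<close>. Restricting to \<^const>\<open>extensional\<close> functions only fixes
  the irrelevant values outside the space. See \<open>tau_is_continuous_extension\<close> and \<open>tau_eq\<close> below.
\<close>

definition tau :: "nat filter \<Rightarrow> nat filter" where
  "tau = (THE f. f \<in> extensional (topspace betaN) \<and> continuous_map betaN betaN f \<and>
                 (\<forall>n\<in>Npos. f (principal {n}) = principal {n + 1}))"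

text \<open>Integer powers of the bijection \<open>tau\<close> of \<open>Nstar\<close>; see \<open>bij_betw_tau\<close>.\<close>

definition tau_pow :: "int \<Rightarrow> nat filter \<Rightarrow> nat filter" where
  "tau_pow k \<omega> = (if k \<ge> 0 then (tau ^^ nat k) \<omega> else (inv_into Nstar tau ^^ nat (- k)) \<omega>)"

definition orbit :: "nat filter \<Rightarrow> nat filter set" where
  "orbit \<omega> = {tau_pow k \<omega> | k. True}"


section \<open>The space \<open>Omega_star\<close>\<close>

abbreviation cylinder :: "(nat filter \<times> real) set" where
  "cylinder \<equiv> Nstar \<times> {0..1}"

text \<open>The least equivalence relation on the cylinder identifying \<open>(\<omega>, 1)\<close> with \<open>(tau \<omega>, 0)\<close>.\<close>

definition gluing :: "((nat filter \<times> real) \<times> (nat filter \<times> real)) set" where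
  "gluing = {((\<omega>, 1), (tau \<omega>, 0)) | \<omega>. \<omega> \<in> Nstar}"

definition glue_rel :: "((nat filter \<times> real) \<times> (nat filter \<times> real)) set" where
  "glue_rel = (gluing \<union> gluing\<inverse>)\<^sup>* \<inter> cylinder \<times> cylinder"

text \<open>The quotient topology: for a set \<open>U\<close> of classes, \<open>\<Union>U\<close> is its preimage in the cylinder.\<close>

definition Omega_star :: "(nat filter \<times> real) set topology" where
  "Omega_star = topology (\<lambda>U. U \<subseteq> cylinder // glue_rel \<and>
     openin (prod_topology (subtopology betaN Nstar) (top_of_set {0..1})) (\<Union>U))"

definition Omega_point :: "nat filter \<Rightarrow> real \<Rightarrow> (nat filter \<times> real) set" where
  "Omega_point \<omega> t = glue_rel `` {(\<omega>, t)}"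


section \<open>The measures and singularity\<close>

definition nu_rep :: "nat filter \<Rightarrow> real \<Rightarrow> nat set \<Rightarrow> real" where
  "nu_rep \<omega> t A = (let \<theta> = 2 powr t in
     Lim \<omega> (\<lambda>n. real (card (A \<inter> {1..nat \<lfloor>\<theta> * 2 ^ n\<rfloor>})) / (\<theta> * 2 ^ n)))"

text \<open>
  The common value of \<open>nu_rep\<close> on the representatives of a point of \<open>Omega_star\<close>; see
  \<open>nu_Omega_point\<close>.
\<close>

definition nu :: "(nat filter \<times> real) set \<Rightarrow> nat set \<Rightarrow> real" where
  "nu \<eta> = the_elem ((\<lambda>(\<omega>, t). nu_rep \<omega> t) ` \<eta>)"

text \<open>
  Set functions on the power set of \<open>Npos\<close> are functions on \<^typ>\<open>nat set\<close>, of which only the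
  values on subsets of \<open>Npos\<close> matter.
\<close>

definition fin_additive_prob :: "(nat set \<Rightarrow> real) \<Rightarrow> bool" where
  "fin_additive_prob \<mu> \<longleftrightarrow> (\<forall>A\<subseteq>Npos. \<mu> A \<ge> 0) \<and> \<mu> Npos = 1 \<and>
     (\<forall>A B. A \<subseteq> Npos \<and> B \<subseteq> Npos \<and> A \<inter> B = {} \<longrightarrow> \<mu> (A \<union> B) = \<mu> A + \<mu> B)"

definition mutually_singular :: "(nat set \<Rightarrow> real) \<Rightarrow> (nat set \<Rightarrow> real) \<Rightarrow> bool" where
  "mutually_singular \<mu> \<nu> \<longleftrightarrow>
     (\<forall>\<epsilon>>0. \<exists>D. D \<subseteq> Npos \<and> \<mu> D < \<epsilon> \<and> \<nu> (Npos - D) < \<epsilon>)"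


section \<open>Well-definedness\<close>

lemma topspace_betaN [simp]: "topspace betaN = ultrafilters"
proof -
  have "basic_open Npos = ultrafilters"
    unfolding basic_open_def ultrafilters_def by blast
  moreover have "basic_open A \<subseteq> ultrafilters" for A
    unfolding basic_open_def by blast
  ultimately have "\<Union> (basic_open ` Pow Npos) = ultrafilters" by blast
  then show ?thesis by (simp add: betaN_def)
qed

lemma ultrafilters_dichotomy:
  assumes "F \<in> ultrafilters"
  shows "eventually P F \<or> eventually (\<lambda>n. \<not> P n) F"
proof -
  have "{n \<in> Npos. P n} \<subseteq> Npos" by auto
  then have "eventually (\<lambda>n. n \<in> {n \<in> Npos. P n}) F \<or> eventually (\<lambda>n. n \<in> Npos - {n \<in> Npos. P n}) F"
    using assms unfolding ultrafilters_def by blast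
  moreover have "eventually P F" if "eventually (\<lambda>n. n \<in> {n \<in> Npos. P n}) F"
    by (rule eventually_mono[OF that]) blast
  moreover have "eventually (\<lambda>n. \<not> P n) F" if "eventually (\<lambda>n. n \<in> Npos - {n \<in> Npos. P n}) F"
    by (rule eventually_mono[OF that]) blast
  ultimately show ?thesis by blast
qed

lemma openin_betaN_basis:
  assumes "openin betaN U" "F \<in> U"
  shows "\<exists>A\<subseteq>Npos. eventually (\<lambda>n. n \<in> A) F \<and> basic_open A \<subseteq> U"
proof -
  have "generate_topology_on (basic_open ` Pow Npos) U"
    using assms(1) by (simp add: betaN_def openin_topology_generated_by)
  then show ?thesis using assms(2)
  proof (induction)
    case (Int a b)
    then obtain A B where AB: "A \<subseteq> Npos" "eventually (\<lambda>n. n \<in> A) F" "basic_open A \<subseteq> a"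
      "B \<subseteq> Npos" "eventually (\<lambda>n. n \<in> B) F" "basic_open B \<subseteq> b" by blast
    have "basic_open (A \<inter> B) \<subseteq> a \<inter> b"
      using AB by (auto simp: basic_open_def eventually_conj_iff)
    then show ?case using AB by (intro exI[of _ "A \<inter> B"]) (auto simp: eventually_conj_iff)
  next
    case (UN K)
    then show ?case by (meson Union_upper UnionE subset_trans)
  next
    case (Basis s)
    then obtain A where "A \<subseteq> Npos" "s = basic_open A" by blast
    then show ?case using Basis by (intro exI[of _ A]) (simp add: basic_open_def)
  qed simp
qed

lemma principal_in_ultrafilters: "n \<in> Npos \<Longrightarrow> principal {n} \<in> ultrafilters"
  by (auto simp: ultrafilters_def eventually_principal principal_eq_bot_iff)

lemma ultrafilters_eqI:
  assumes F: "F \<in> ultrafilters" and G: "G \<in> ultrafilters"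
    and le: "\<And>A. A \<subseteq> Npos \<Longrightarrow> eventually (\<lambda>n. n \<in> A) F \<Longrightarrow> eventually (\<lambda>n. n \<in> A) G"
  shows "F = G"
proof (rule filter_eq_iff[THEN iffD2], intro allI)
  fix P
  let ?A = "{n \<in> Npos. P n}"
  have evF: "eventually P F \<longleftrightarrow> eventually (\<lambda>n. n \<in> ?A) F"
    using F by (auto simp: ultrafilters_def eventually_conj_iff)
  have evG: "eventually P G \<longleftrightarrow> eventually (\<lambda>n. n \<in> ?A) G"
    using G by (auto simp: ultrafilters_def eventually_conj_iff)
  show "eventually P F \<longleftrightarrow> eventually P G"
  proof
    assume "eventually P F"
    then show "eventually P G" using evF evG le[of ?A] by auto
  next
    assume PG: "eventually P G"
    show "eventually P F"
    proof (rule ccontr)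
      assume "\<not> eventually P F"
      then have "\<not> eventually (\<lambda>n. n \<in> ?A) F" using evF by blast
      moreover have "?A \<subseteq> Npos" by auto
      ultimately have "eventually (\<lambda>n. n \<in> Npos - ?A) F"
        using F unfolding ultrafilters_def by blast
      then have "eventually (\<lambda>n. n \<in> Npos - ?A) G" by (intro le) auto
      with PG have "eventually (\<lambda>n. False) G" by eventually_elim auto
      then show False using G by (simp add: ultrafilters_def trivial_limit_def)
    qed
  qed
qed

lemma filtermap_Suc_ultrafilters:
  assumes "F \<in> ultrafilters" shows "filtermap Suc F \<in> ultrafilters"
proof -
  have "eventually (\<lambda>n. Suc n \<in> A) F \<or> eventually (\<lambda>n. Suc n \<in> Npos - A) F" for A
    using ultrafilters_dichotomy[OF assms, of "\<lambda>n. Suc n \<in> A"] by (simp add: Npos_def)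
  then show ?thesis using assms
    by (simp add: ultrafilters_def eventually_filtermap filtermap_bot_iff Npos_def)
qed

lemma continuous_extension_unique:
  assumes f: "continuous_map betaN betaN f" and g: "continuous_map betaN betaN g"
    and eq: "\<forall>n\<in>Npos. f (principal {n}) = g (principal {n})" and F: "F \<in> ultrafilters"
  shows "f F = g F"
proof (rule ultrafilters_eqI)
  show fF: "f F \<in> ultrafilters" and gF: "g F \<in> ultrafilters"
    using f g F by (auto simp: continuous_map_def)
  fix A assume A: "A \<subseteq> Npos" "eventually (\<lambda>n. n \<in> A) (f F)"
  show "eventually (\<lambda>n. n \<in> A) (g F)"
  proof (rule ccontr)
    assume "\<not> eventually (\<lambda>n. n \<in> A) (g F)"
    then have B: "eventually (\<lambda>n. n \<in> Npos - A) (g F)"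
      using gF A unfolding ultrafilters_def by blast
    let ?U = "{G \<in> topspace betaN. f G \<in> basic_open A} \<inter> {G \<in> topspace betaN. g G \<in> basic_open (Npos - A)}"
    have "openin betaN (basic_open C)" if "C \<subseteq> Npos" for C
      using that unfolding betaN_def by (auto intro!: topology_generated_by_Basis)
    then have "openin betaN ?U"
      using A by (intro openin_Int openin_continuous_map_preimage[OF f]
          openin_continuous_map_preimage[OF g]) auto
    moreover have "F \<in> ?U" using F A B fF gF by (simp add: basic_open_def)
    ultimately obtain C where C: "C \<subseteq> Npos" "eventually (\<lambda>n. n \<in> C) F" "basic_open C \<subseteq> ?U"
      using openin_betaN_basis by meson
    have "C \<noteq> {}" using C(2) F by (auto simp: ultrafilters_def)
    then obtain n where n: "n \<in> C" by auto
    then have "principal {n} \<in> basic_open C"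
      using C(1) principal_in_ultrafilters[of n] by (auto simp: basic_open_def eventually_principal)
    then have "principal {n} \<in> ?U" using C(3) by blast
    then have *: "eventually (\<lambda>n. n \<in> A) (f (principal {n}))"
      "eventually (\<lambda>n. n \<in> Npos - A) (f (principal {n}))" "f (principal {n}) \<in> ultrafilters"
      using eq n C(1) by (auto simp: basic_open_def)
    from *(1,2) have "eventually (\<lambda>n. False) (f (principal {n}))" by eventually_elim auto
    then show False using *(3) by (simp add: ultrafilters_def trivial_limit_def)
  qed
qed

lemma continuous_map_filtermap_Suc: "continuous_map betaN betaN (filtermap Suc)"
proof -
  have pre: "filtermap Suc -` basic_open A \<inter> topspace betaN
      = basic_open {n \<in> Npos. Suc n \<in> A}" for A
    using filtermap_Suc_ultrafilters
    by (auto simp: basic_open_def ultrafilters_def eventually_filtermap eventually_conj_iff)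
  show ?thesis
    unfolding betaN_def
  proof (rule continuous_on_generated_topo, fold betaN_def)
    fix U assume "U \<in> basic_open ` Pow Npos"
    then obtain A where "U = basic_open A" by auto
    then show "openin betaN (filtermap Suc -` U \<inter> topspace betaN)"
      by (auto simp only: pre) (auto simp: betaN_def intro!: topology_generated_by_Basis)
  next
    have "\<Union> (basic_open ` Pow Npos) = topspace betaN"
      unfolding betaN_def by simp
    then show "filtermap Suc ` topspace betaN \<subseteq> \<Union> (basic_open ` Pow Npos)"
      using filtermap_Suc_ultrafilters by auto
  qed
qed

lemma tau_restrict: "tau = restrict (filtermap Suc) (topspace betaN)"
  unfolding tau_def
proof (rule the_equality, goal_cases)
  case 1
  have "continuous_map betaN betaN (restrict (filtermap Suc) (topspace betaN))"
    using continuous_map_eq[OF continuous_map_filtermap_Suc] by simp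
  then show ?case
    using principal_in_ultrafilters by (auto simp: filtermap_principal)
next
  case (2 f)
  show ?case
  proof
    fix F
    show "f F = restrict (filtermap Suc) (topspace betaN) F"
    proof (cases "F \<in> ultrafilters")
      case True
      have "f F = filtermap Suc F"
        using 2 True
        by (intro continuous_extension_unique[OF _ continuous_map_filtermap_Suc])
           (auto simp: filtermap_principal)
      then show ?thesis using True by simp
    next
      case False
      then show ?thesis using 2 by (auto simp: extensional_def)
    qed
  qed
qed

lemma tau_eq: "\<omega> \<in> topspace betaN \<Longrightarrow> tau \<omega> = filtermap Suc \<omega>"
  by (simp add: tau_restrict)

lemma tau_is_continuous_extension:
  "continuous_map betaN betaN tau" "n \<in> Npos \<Longrightarrow> tau (principal {n}) = principal {n + 1}"
  using continuous_map_eq[OF continuous_map_filtermap_Suc, of tau] tau_eq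
    principal_in_ultrafilters[of n] by (simp_all add: filtermap_principal)

lemma Nstar_iff:
  "\<omega> \<in> Nstar \<longleftrightarrow> \<omega> \<in> ultrafilters \<and> \<omega> \<le> sequentially"
proof
  assume \<omega>: "\<omega> \<in> Nstar"
  then have u: "\<omega> \<in> ultrafilters" by (simp add: Nstar_def)
  have ne: "eventually (\<lambda>n. n \<noteq> k) \<omega>" for k
  proof (rule ccontr)
    assume "\<not> eventually (\<lambda>n. n \<noteq> k) \<omega>"
    then have ev: "eventually (\<lambda>n. n = k) \<omega>"
      using ultrafilters_dichotomy[OF u, of "\<lambda>n. n = k"] by blast
    have Npos: "eventually (\<lambda>n. n \<in> Npos) \<omega>" using u by (simp add: ultrafilters_def)
    have k: "k \<in> Npos"
    proof (rule ccontr)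
      assume "k \<notin> Npos"
      with ev have "eventually (\<lambda>n. n \<notin> Npos) \<omega>" by (auto elim: eventually_mono)
      with Npos have "eventually (\<lambda>n. False) \<omega>" by eventually_elim auto
      then show False using u by (simp add: ultrafilters_def trivial_limit_def)
    qed
    have "eventually (\<lambda>n. n \<in> A) \<omega>" if "eventually (\<lambda>n. n \<in> A) (principal {k})" for A
      using ev that by (auto simp: eventually_principal elim: eventually_mono)
    then have "principal {k} = \<omega>"
      by (intro ultrafilters_eqI principal_in_ultrafilters k u)
    then show False using \<omega> k by (auto simp: Nstar_def)
  qed
  have "eventually (\<lambda>n. \<forall>k\<in>{..<N}. n \<noteq> k) \<omega>" for N :: nat
    using ne by (intro eventually_ball_finite) auto
  then have "eventually (\<lambda>n. N \<le> n) \<omega>" for N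
    by (rule eventually_mono[of _ _ "\<lambda>n. N \<le> n"]) (use not_le_imp_less in blast)
  then show "\<omega> \<in> ultrafilters \<and> \<omega> \<le> sequentially"
    using u filterlim_at_top[of "\<lambda>x. x" \<omega>] by (simp add: filterlim_def filtermap_ident)
next
  assume \<omega>: "\<omega> \<in> ultrafilters \<and> \<omega> \<le> sequentially"
  have "\<not> principal {n} \<le> sequentially" for n :: nat
    using filterlim_at_top[of "\<lambda>x. x" "principal {n}"]
    by (auto simp: filterlim_def filtermap_ident eventually_principal intro!: exI[of _ "Suc n"])
  then show "\<omega> \<in> Nstar" using \<omega> by (auto simp: Nstar_def)
qed

lemma Nstar_subset: "Nstar \<subseteq> ultrafilters"
  by (auto simp: Nstar_def)

lemma bij_betw_tau: "bij_betw tau Nstar Nstar"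
proof -
  have maps: "tau F \<in> Nstar" if "F \<in> Nstar" for F
  proof -
    have "filtermap Suc F \<le> filtermap Suc sequentially"
      using that by (intro filtermap_mono) (simp add: Nstar_iff)
    also have "\<dots> \<le> sequentially"
      using filterlim_Suc by (simp add: filterlim_def)
    finally show ?thesis
      using that filtermap_Suc_ultrafilters by (simp add: Nstar_iff tau_eq)
  qed
  have inj: "inj_on tau Nstar"
  proof (rule inj_onI)
    fix F G assume FG: "F \<in> Nstar" "G \<in> Nstar" "tau F = tau G"
    then have "filtermap (\<lambda>n. n - 1) (filtermap Suc F) = filtermap (\<lambda>n. n - 1) (filtermap Suc G)"
      by (simp add: Nstar_iff tau_eq)
    then show "F = G" by (simp add: filtermap_filtermap filtermap_ident)
  qed
  have surj: "\<exists>F\<in>Nstar. tau F = G" if "G \<in> Nstar" for G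
  proof -
    have G: "G \<in> ultrafilters" "G \<le> sequentially" using that by (auto simp: Nstar_iff)
    let ?F = "filtermap (\<lambda>n. n - 1) G"
    have ge: "eventually (\<lambda>n. n \<ge> N) G" for N
      using G(2) eventually_ge_at_top[of N] by (auto simp: le_filter_def)
    have pos: "eventually (\<lambda>n. n - 1 \<in> Npos) G"
      using ge[of 2] by eventually_elim (auto simp: Npos_def)
    have "eventually (\<lambda>n. n - 1 \<in> A) G \<or> eventually (\<lambda>n. n - 1 \<in> Npos - A) G" for A
    proof -
      have "eventually (\<lambda>n. n - 1 \<in> Npos - A) G" if "eventually (\<lambda>n. n - 1 \<notin> A) G"
        using pos that by eventually_elim auto
      then show ?thesis
        using ultrafilters_dichotomy[OF G(1), of "\<lambda>n. n - 1 \<in> A"] by blast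
    qed
    then have u: "?F \<in> ultrafilters"
      using G(1) pos by (simp add: ultrafilters_def eventually_filtermap filtermap_bot_iff)
    have "eventually (\<lambda>n. N \<le> n - 1) G" for N
      using ge[of "N + 1"] by eventually_elim auto
    then have "filterlim (\<lambda>n. n - 1) sequentially G" by (simp add: filterlim_at_top)
    then have F: "?F \<in> Nstar" using u by (simp add: Nstar_iff filterlim_def)
    have "filtermap Suc ?F = G"
    proof (rule ultrafilters_eqI[OF filtermap_Suc_ultrafilters[OF u] G(1)])
      fix A assume "eventually (\<lambda>n. n \<in> A) (filtermap Suc ?F)"
      then have "eventually (\<lambda>n. Suc (n - 1) \<in> A) G" by (simp add: eventually_filtermap)
      with ge[of 1] show "eventually (\<lambda>n. n \<in> A) G" by eventually_elim auto
    qed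
    then have "tau ?F = G" using u by (simp add: tau_eq)
    then show ?thesis using F by blast
  qed
  show ?thesis using maps inj surj by (auto simp: bij_betw_def)
qed

lemma equiv_glue_rel: "equiv cylinder glue_rel"
proof -
  have "sym ((gluing \<union> gluing\<inverse>)\<^sup>*)" by (intro sym_rtrancl) (auto simp: sym_def)
  then show ?thesis
    unfolding glue_rel_def by (auto simp: equiv_def refl_on_def sym_def trans_def)
qed

lemma istopology_Omega_star:
  "istopology (\<lambda>U. U \<subseteq> cylinder // glue_rel \<and>
     openin (prod_topology (subtopology betaN Nstar) (top_of_set {0..1})) (\<Union>U))"
proof -
  have "\<Union>(U \<inter> V) = \<Union>U \<inter> \<Union>V"
    if "U \<subseteq> cylinder // glue_rel" "V \<subseteq> cylinder // glue_rel" for U V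
    using that quotient_disj[OF equiv_glue_rel] by blast
  moreover have "openin X (\<Union>(\<Union>K))" if "\<forall>U\<in>K. openin X (\<Union>U)"
    for X and K :: "(nat filter \<times> real) set set set"
  proof -
    have "\<Union>(\<Union>K) = \<Union>(Union ` K)" by blast
    moreover have "openin X (\<Union>(Union ` K))" using that by (intro openin_Union) blast
    ultimately show ?thesis by simp
  qed
  ultimately show ?thesis
    unfolding istopology_def by (auto simp: openin_Int)
qed

lemma topspace_Omega_star: "topspace Omega_star = cylinder // glue_rel"
proof -
  have "openin Omega_star (cylinder // glue_rel)"
    unfolding Omega_star_def topology_inverse'[OF istopology_Omega_star]
    using openin_topspace[of "prod_topology (subtopology betaN Nstar) (top_of_set {0..1::real})"]
    by (simp add: Union_quotient[OF equiv_glue_rel] Int_absorb1 Nstar_subset)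
  moreover have "U \<subseteq> cylinder // glue_rel" if "openin Omega_star U" for U
    using that unfolding Omega_star_def topology_inverse'[OF istopology_Omega_star] by blast
  ultimately show ?thesis
    by (meson openin_subset openin_topspace subset_antisym)
qed

lemma Omega_point_in_Omega_star:
  "\<omega> \<in> Nstar \<Longrightarrow> t \<in> {0..1} \<Longrightarrow> Omega_point \<omega> t \<in> topspace Omega_star"
  unfolding topspace_Omega_star Omega_point_def by (auto intro: quotientI)

lemma nu_rep_tau:
  assumes "\<omega> \<in> Nstar" shows "nu_rep (tau \<omega>) 0 = nu_rep \<omega> 1"
proof -
  have "Lim (filtermap Suc \<omega>) f = Lim \<omega> (\<lambda>n. f (Suc n))" for f :: "nat \<Rightarrow> real"
    unfolding Topological_Spaces.Lim_def filterlim_filtermap ..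
  then show ?thesis
    using assms by (simp add: fun_eq_iff nu_rep_def Let_def Nstar_iff tau_eq)
qed

lemma nu_Omega_point:
  assumes "\<omega> \<in> Nstar" "t \<in> {0..1}"
  shows "nu (Omega_point \<omega> t) = nu_rep \<omega> t"
proof -
  let ?n = "\<lambda>(\<omega>, t). nu_rep \<omega> t"
  have "?n p = ?n q" if "(p, q) \<in> (gluing \<union> gluing\<inverse>)\<^sup>*" for p q
    using that by induction (auto simp: gluing_def nu_rep_tau)
  then have "?n q = nu_rep \<omega> t" if "q \<in> Omega_point \<omega> t" for q
    using that by (fastforce simp: Omega_point_def glue_rel_def)
  moreover have "(\<omega>, t) \<in> Omega_point \<omega> t"
    using assms by (simp add: Omega_point_def glue_rel_def)
  ultimately have "?n ` Omega_point \<omega> t = {nu_rep \<omega> t}"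
    by (metis (no_types, lifting) image_cong image_constant)
  then show ?thesis by (simp add: nu_def)
qed

lemma ultrafilter_bounded_convergent:
  fixes f :: "nat \<Rightarrow> real"
  assumes F: "F \<in> ultrafilters" and f: "\<And>n. f n \<in> {0..1}"
  shows "\<exists>l. (f \<longlongrightarrow> l) F"
proof -
  have "compact {0..1::real}" by simp
  moreover have "filtermap f F \<noteq> bot" using F by (simp add: ultrafilters_def filtermap_bot_iff)
  moreover have "eventually (\<lambda>x. x \<in> {0..1}) (filtermap f F)"
    using f by (simp add: eventually_filtermap)
  ultimately obtain l where l: "inf (nhds l) (filtermap f F) \<noteq> bot"
    unfolding compact_filter by blast
  have "(f \<longlongrightarrow> l) F"
  proof (rule topological_tendstoI, rule ccontr)
    fix S assume S: "open S" "l \<in> S" and no: "\<not> eventually (\<lambda>n. f n \<in> S) F"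
    have "eventually (\<lambda>n. f n \<notin> S) F"
      using ultrafilters_dichotomy[OF F, of "\<lambda>n. f n \<in> S"] no by blast
    then have "eventually (\<lambda>x. x \<notin> S) (filtermap f F)"
      by (simp add: eventually_filtermap)
    moreover have "eventually (\<lambda>x. x \<in> S) (nhds l)"
      using S by (simp add: eventually_nhds) blast
    ultimately have "eventually (\<lambda>x. False) (inf (nhds l) (filtermap f F))"
      unfolding eventually_inf by blast
    then show False using l by (simp add: trivial_limit_def)
  qed
  then show ?thesis by blast
qed

lemma nu_rep_tendsto:
  assumes "\<omega> \<in> Nstar"
  shows "((\<lambda>n. real (card (A \<inter> {1..nat \<lfloor>2 powr t * 2 ^ n\<rfloor>})) / (2 powr t * 2 ^ n))
           \<longlongrightarrow> nu_rep \<omega> t A) \<omega>" (is "(?f \<longlongrightarrow> _) _")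
proof -
  have u: "\<omega> \<in> ultrafilters" using assms by (simp add: Nstar_iff)
  have "?f n \<in> {0..1}" for n
  proof -
    have "card (A \<inter> {1..nat \<lfloor>2 powr t * 2 ^ n\<rfloor>}) \<le> card {1..nat \<lfloor>2 powr t * 2 ^ n\<rfloor>}"
      by (intro card_mono) auto
    then have "real (card (A \<inter> {1..nat \<lfloor>2 powr t * 2 ^ n\<rfloor>})) \<le> real (nat \<lfloor>2 powr t * 2 ^ n\<rfloor>)"
      using of_nat_le_iff[where 'a = real] by (metis card_atLeastAtMost diff_Suc_1)
    also have "\<dots> \<le> 2 powr t * 2 ^ n" by (intro of_nat_floor) simp
    finally show ?thesis by (simp add: divide_le_eq)
  qed
  then obtain l where l: "(?f \<longlongrightarrow> l) \<omega>"
    using ultrafilter_bounded_convergent[OF u, of ?f] by blast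
  then have "nu_rep \<omega> t A = l"
    unfolding nu_rep_def Let_def using u
    by (intro tendsto_Lim) (auto simp: ultrafilters_def)
  then show ?thesis using l by simp
qed

lemma fin_additive_prob_nu:
  assumes "\<omega> \<in> Nstar" "t \<in> {0..1}"
  shows "fin_additive_prob (nu (Omega_point \<omega> t))"
proof -
  have nb: "\<omega> \<noteq> bot" using assms by (simp add: Nstar_iff ultrafilters_def)
  note lim = nu_rep_tendsto[OF assms(1), of _ t]
  have nonneg: "nu_rep \<omega> t A \<ge> 0" for A
    by (rule tendsto_lowerbound[OF lim _ nb]) (auto intro!: always_eventually)
  have add: "nu_rep \<omega> t (A \<union> B) = nu_rep \<omega> t A + nu_rep \<omega> t B" if "A \<inter> B = {}" for A B
  proof (rule tendsto_unique[OF nb lim])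
    have "card ((A \<union> B) \<inter> {1..m}) = card (A \<inter> {1..m}) + card (B \<inter> {1..m})" for m :: nat
      unfolding Int_Un_distrib2 by (rule card_Un_disjoint) (use that in auto)
    then show "((\<lambda>n. real (card ((A \<union> B) \<inter> {1..nat \<lfloor>2 powr t * 2 ^ n\<rfloor>})) / (2 powr t * 2 ^ n))
        \<longlongrightarrow> nu_rep \<omega> t A + nu_rep \<omega> t B) \<omega>"
      using tendsto_add[OF lim[of A] lim[of B]] by (simp add: add_divide_distrib)
  qed
  have one: "nu_rep \<omega> t Npos = 1"
  proof (rule tendsto_unique[OF nb lim])
    have "Npos \<inter> {1..m} = {1..m}" for m by (auto simp: Npos_def)
    moreover have "((\<lambda>n. real (nat \<lfloor>2 powr t * 2 ^ n\<rfloor>) / (2 powr t * 2 ^ n)) \<longlongrightarrow> 1) sequentially"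
    proof (rule tendsto_sandwich[OF _ _ _ tendsto_const])
      show "((\<lambda>n. 1 - (1 / 2 powr t) * (1 / 2) ^ n) \<longlongrightarrow> 1) sequentially"
        by (auto intro!: tendsto_eq_intros LIMSEQ_power_zero)
      have "1 - (1 / 2 powr t) * (1 / 2) ^ n \<le> real (nat \<lfloor>2 powr t * 2 ^ n\<rfloor>) / (2 powr t * 2 ^ n)" for n
      proof -
        have "2 powr t * 2 ^ n - 1 \<le> real (nat \<lfloor>2 powr t * 2 ^ n\<rfloor>)" by linarith
        then have "(2 powr t * 2 ^ n - 1) / (2 powr t * 2 ^ n)
            \<le> real (nat \<lfloor>2 powr t * 2 ^ n\<rfloor>) / (2 powr t * 2 ^ n)"
          by (intro divide_right_mono) auto
        moreover have "(2 powr t * 2 ^ n - 1) / (2 powr t * 2 ^ n) = 1 - (1 / 2 powr t) * (1 / 2) ^ n"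
          by (simp add: diff_divide_distrib power_divide)
        ultimately show ?thesis by linarith
      qed
      then show "eventually (\<lambda>n. 1 - (1 / 2 powr t) * (1 / 2) ^ n
          \<le> real (nat \<lfloor>2 powr t * 2 ^ n\<rfloor>) / (2 powr t * 2 ^ n)) sequentially" by simp
      have "real (nat \<lfloor>2 powr t * 2 ^ n\<rfloor>) \<le> 2 powr t * 2 ^ n" for n
        by (intro of_nat_floor) simp
      then show "eventually (\<lambda>n. real (nat \<lfloor>2 powr t * 2 ^ n\<rfloor>) / (2 powr t * 2 ^ n) \<le> 1) sequentially"
        by (simp add: divide_le_eq)
    qed
    ultimately show "((\<lambda>n. real (card (Npos \<inter> {1..nat \<lfloor>2 powr t * 2 ^ n\<rfloor>})) / (2 powr t * 2 ^ n))
        \<longlongrightarrow> 1) \<omega>"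
      using assms(1) by (auto simp: Nstar_iff intro: tendsto_mono)
  qed
  show ?thesis
    using nonneg add one by (simp add: nu_Omega_point[OF assms] fin_additive_prob_def)
qed

end

theory Submission
  imports Defs
begin

text \<open>
  Shifting \<open>\<omega>\<close> by \<open>k\<close> rescales the window \<open>[1, 2\<^sup>t\<^sup>+\<^sup>n]\<close> by the factor \<open>2\<^sup>k\<close>. On one orbit
  the measures therefore average over windows of bounded ratio, so the one with the larger window
  dominates a multiple of the other, and they are not singular. If the orbits differ, then for
  every \<open>m\<close> there are \<open>B \<in> \<omega>\<close> and \<open>B' \<in> \<omega>'\<close> at distance greater than \<open>m\<close> from each other. The
  union of the blocks \<open>(2\<^sup>t\<^sup>+\<^sup>b\<^sup>-\<^sup>m, 2\<^sup>t\<^sup>+\<^sup>b]\<close> with \<open>b \<in> B\<close> then carries all but \<open>2\<^sup>-\<^sup>m\<close> of \<open>\<nu>\<^sub>\<eta>\<close> and at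
  most \<open>2\<^sup>-\<^sup>m\<close> of \<open>\<nu>\<^sub>\<eta>\<^sub>'\<close>.
\<close>

section \<open>Iterates of \<open>tau\<close> and orbits\<close>

lemma tau_funpow_Nstar: "F \<in> Nstar \<Longrightarrow> (tau ^^ k) F \<in> Nstar"
  by (induction k) (auto intro: bij_betwE[OF bij_betw_tau, rule_format])

lemma tau_funpow_eq:
  assumes "F \<in> Nstar"
  shows "(tau ^^ k) F = filtermap (\<lambda>n. n + k) F"
proof (induction k)
  case 0
  then show ?case by (simp add: filtermap_ident)
next
  case (Suc k)
  have "(tau ^^ k) F \<in> ultrafilters"
    using tau_funpow_Nstar[OF assms] Nstar_subset by blast
  then show ?case
    using Suc by (simp add: tau_eq filtermap_filtermap)
qed

lemma tau_funpow_inject: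
  assumes "F \<in> Nstar" "G \<in> Nstar" "(tau ^^ k) F = (tau ^^ k) G"
  shows "F = G"
  using bij_betw_funpow[OF bij_betw_tau, of k] assms
  by (auto simp: bij_betw_def dest: inj_onD)

lemma inv_tau_funpow:
  assumes "F \<in> Nstar"
  shows "(inv_into Nstar tau ^^ k) F \<in> Nstar" "(tau ^^ k) ((inv_into Nstar tau ^^ k) F) = F"
proof -
  have bij: "bij_betw (inv_into Nstar tau) Nstar Nstar"
    by (rule bij_betw_inv_into[OF bij_betw_tau])
  show mem: "(inv_into Nstar tau ^^ k) F \<in> Nstar" for k
    by (induction k) (use assms bij in \<open>auto intro: bij_betwE[OF bij, rule_format]\<close>)
  show "(tau ^^ k) ((inv_into Nstar tau ^^ k) F) = F"
  proof (induction k)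
    case (Suc k)
    then show ?case
      using bij_betw_inv_into_right[OF bij_betw_tau mem[of k]] by (simp add: funpow_swap1)
  qed simp
qed

text \<open>Trading integer powers for natural iterates on both sides removes the inverse of
  \<open>tau\<close>; by \<open>tau_funpow_eq\<close>, lying on one orbit then means that two shifts
  agree as filters.\<close>

lemma orbit_iff:
  assumes "\<omega> \<in> Nstar"
  shows "\<sigma> \<in> orbit \<omega> \<longleftrightarrow> \<sigma> \<in> Nstar \<and> (\<exists>i j. (tau ^^ i) \<omega> = (tau ^^ j) \<sigma>)"
proof
  assume "\<sigma> \<in> orbit \<omega>"
  then obtain k where k: "\<sigma> = tau_pow k \<omega>" by (auto simp: orbit_def)
  show "\<sigma> \<in> Nstar \<and> (\<exists>i j. (tau ^^ i) \<omega> = (tau ^^ j) \<sigma>)"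
  proof (cases "k \<ge> 0")
    case True
    then have "(tau ^^ nat k) \<omega> = (tau ^^ 0) \<sigma>" using k by (simp add: tau_pow_def)
    then show ?thesis
      using True k tau_funpow_Nstar[OF assms, of "nat k"] by (metis tau_pow_def)
  next
    case False
    then have "(tau ^^ 0) \<omega> = (tau ^^ nat (- k)) \<sigma>"
      using k inv_tau_funpow(2)[OF assms] by (simp add: tau_pow_def)
    then show ?thesis
      using False k inv_tau_funpow(1)[OF assms, of "nat (- k)"] by (metis tau_pow_def)
  qed
next
  assume "\<sigma> \<in> Nstar \<and> (\<exists>i j. (tau ^^ i) \<omega> = (tau ^^ j) \<sigma>)"
  then obtain i j where \<sigma>: "\<sigma> \<in> Nstar" and eq: "(tau ^^ i) \<omega> = (tau ^^ j) \<sigma>" by blast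
  show "\<sigma> \<in> orbit \<omega>"
  proof (cases "j \<le> i")
    case True
    \<comment> \<open>The smaller of the two exponents is split off and cancelled by injectivity of
      \<open>tau\<close> on \<open>Nstar\<close>.\<close>
    then have "(tau ^^ j) ((tau ^^ (i - j)) \<omega>) = (tau ^^ j) \<sigma>"
      using eq funpow_add[of j "i - j" tau] by simp
    then have "(tau ^^ (i - j)) \<omega> = \<sigma>"
      using tau_funpow_inject tau_funpow_Nstar assms \<sigma> by blast
    then have "\<sigma> = tau_pow (int (i - j)) \<omega>" by (simp only: tau_pow_def nat_int) simp
    then show ?thesis unfolding orbit_def by blast
  next
    case False
    then have "(tau ^^ i) ((tau ^^ (j - i)) \<sigma>) = (tau ^^ i) \<omega>"
      using eq funpow_add[of i "j - i" tau] by simp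
    then have "(tau ^^ (j - i)) \<sigma> = (tau ^^ (j - i)) ((inv_into Nstar tau ^^ (j - i)) \<omega>)"
      using tau_funpow_inject tau_funpow_Nstar assms \<sigma> inv_tau_funpow(2) by metis
    then have "\<sigma> = (inv_into Nstar tau ^^ (j - i)) \<omega>"
      using tau_funpow_inject inv_tau_funpow(1) assms \<sigma> by blast
    then have "\<sigma> = tau_pow (- int (j - i)) \<omega>"
      using False by (simp only: tau_pow_def minus_minus nat_int) simp
    then show ?thesis unfolding orbit_def by blast
  qed
qed

lemma orbit_refl: "\<omega> \<in> Nstar \<Longrightarrow> \<omega> \<in> orbit \<omega>"
  by (auto simp: orbit_iff)

lemma orbits_disjoint_iff:
  assumes "\<omega> \<in> Nstar" "\<omega>' \<in> Nstar"
  shows "orbit \<omega> \<inter> orbit \<omega>' = {} \<longleftrightarrow> \<omega>' \<notin> orbit \<omega>"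
proof -
  have "\<omega>' \<in> orbit \<omega>" if "\<sigma> \<in> orbit \<omega>" "\<sigma> \<in> orbit \<omega>'" for \<sigma>
  proof -
    from that assms obtain i j k l
      where eq: "(tau ^^ i) \<omega> = (tau ^^ j) \<sigma>" "(tau ^^ k) \<omega>' = (tau ^^ l) \<sigma>"
      by (auto simp: orbit_iff)
    \<comment> \<open>Both points reach the common iterate of \<open>\<sigma>\<close> with exponent
      \<open>j + l\<close>.\<close>
    have "(tau ^^ (l + i)) \<omega> = (tau ^^ l) ((tau ^^ j) \<sigma>)" by (simp add: funpow_add eq)
    also have "\<dots> = (tau ^^ j) ((tau ^^ l) \<sigma>)"
      by (metis add.commute comp_apply funpow_add)
    also have "\<dots> = (tau ^^ (j + k)) \<omega>'" by (simp add: funpow_add eq)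
    finally show ?thesis using assms by (auto simp: orbit_iff)
  qed
  then show ?thesis using orbit_refl[OF assms(2)] by blast
qed

section \<open>Domination on one orbit excludes singularity\<close>

lemma mutually_singular_commute:
  "mutually_singular \<mu> \<nu> \<Longrightarrow> mutually_singular \<nu> \<mu>"
  unfolding mutually_singular_def by (metis Diff_subset double_diff order_refl)

lemma not_mutually_singular_if_dominated:
  assumes \<mu>: "fin_additive_prob \<mu>" and C: "C > 0" and dom: "\<And>A. A \<subseteq> Npos \<Longrightarrow> \<mu> A \<le> C * \<nu> A"
  shows "\<not> mutually_singular \<mu> \<nu>"
proof
  assume "mutually_singular \<mu> \<nu>"
  \<comment> \<open>The bound \<epsilon> = 1 / (1 + C) solves \<epsilon> + C \<epsilon> = 1, so
    strictness of the bound on \<open>\<mu> D\<close> makes the total mass less than 1.\<close>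
  then obtain D where D: "D \<subseteq> Npos" "\<mu> D < 1 / (1 + C)" "\<nu> (Npos - D) < 1 / (1 + C)"
    unfolding mutually_singular_def using C by (meson add_pos_pos divide_pos_pos zero_less_one)
  have "D \<union> (Npos - D) = Npos" using D(1) by blast
  then have "1 = \<mu> D + \<mu> (Npos - D)"
    using \<mu> D(1) unfolding fin_additive_prob_def by (metis Diff_disjoint Diff_subset)
  also have "\<mu> (Npos - D) \<le> C * \<nu> (Npos - D)" by (rule dom) blast
  also have "\<dots> \<le> C * (1 / (1 + C))" using D(3) C by (intro mult_left_mono) auto
  finally have "1 < 1 / (1 + C) + C * (1 / (1 + C))" using D(2) by linarith
  also have "\<dots> = 1" using C by (simp add: add_divide_distrib[symmetric])
  finally show False by simp
qed

text \<open>Reindexing by \<open>n + i\<close> moves the shift out of the ultrafilter and into the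
  window exponent. Two measures on one orbit thereby become limits along the same filter.\<close>

lemma nu_rep_tendsto_shift:
  fixes A :: "nat set" and t :: real and i :: nat
  assumes "\<omega> \<in> Nstar"
  defines "w \<equiv> \<lambda>n. 2 powr (t - real i + real n)"
  shows "((\<lambda>n. real (card (A \<inter> {1..nat \<lfloor>w n\<rfloor>})) / w n) \<longlongrightarrow> nu_rep \<omega> t A) (filtermap (\<lambda>n. n + i) \<omega>)"
proof -
  have "w (n + i) = 2 powr t * 2 ^ n" for n
    by (simp add: w_def powr_add powr_diff powr_realpow power_add)
  then show ?thesis
    using nu_rep_tendsto[OF assms(1), of A t] by (simp add: filterlim_filtermap)
qed

text \<open>Along the common filter, the first window lies inside the second for every
  \<open>n\<close>, so its count is no larger; the constant is the ratio of the window
  lengths.\<close>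

lemma nu_rep_dominated:
  assumes \<omega>: "\<omega> \<in> Nstar" and \<omega>': "\<omega>' \<in> Nstar"
    and eq: "filtermap (\<lambda>n. n + i) \<omega> = filtermap (\<lambda>n. n + j) \<omega>'"
    and le: "t - real i \<le> t' - real j"
  shows "nu_rep \<omega> t A \<le> 2 powr ((t' - real j) - (t - real i)) * nu_rep \<omega>' t' A"
proof (rule tendsto_le)
  show "filtermap (\<lambda>n. n + i) \<omega> \<noteq> bot"
    using \<omega> by (simp add: Nstar_iff ultrafilters_def filtermap_bot_iff)
  show "((\<lambda>n. real (card (A \<inter> {1..nat \<lfloor>2 powr (t - real i + real n)\<rfloor>})) / 2 powr (t - real i + real n))
      \<longlongrightarrow> nu_rep \<omega> t A) (filtermap (\<lambda>n. n + i) \<omega>)"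
    by (rule nu_rep_tendsto_shift[OF \<omega>])
  show "((\<lambda>n. 2 powr ((t' - real j) - (t - real i)) *
        (real (card (A \<inter> {1..nat \<lfloor>2 powr (t' - real j + real n)\<rfloor>})) / 2 powr (t' - real j + real n)))
      \<longlongrightarrow> 2 powr ((t' - real j) - (t - real i)) * nu_rep \<omega>' t' A) (filtermap (\<lambda>n. n + i) \<omega>)"
    unfolding eq by (intro tendsto_mult_left nu_rep_tendsto_shift[OF \<omega>'])
  have "real (card (A \<inter> {1..nat \<lfloor>2 powr (t - real i + real n)\<rfloor>})) / 2 powr (t - real i + real n)
      \<le> 2 powr ((t' - real j) - (t - real i)) *
        (real (card (A \<inter> {1..nat \<lfloor>2 powr (t' - real j + real n)\<rfloor>})) / 2 powr (t' - real j + real n))" for n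
  proof -
    have "(2::real) powr (t - real i + real n) \<le> 2 powr (t' - real j + real n)" using le by simp
    then have "card (A \<inter> {1..nat \<lfloor>2 powr (t - real i + real n)\<rfloor>})
        \<le> card (A \<inter> {1..nat \<lfloor>2 powr (t' - real j + real n)\<rfloor>})"
      by (intro card_mono Int_mono) (auto simp: nat_mono floor_mono intro: order_trans)
    moreover have "2 powr ((t' - real j) - (t - real i)) / 2 powr (t' - real j + real n)
        = 1 / 2 powr (t - real i + real n)"
      by (simp add: powr_diff powr_add)
    ultimately show ?thesis
      by (simp add: divide_right_mono powr_diff powr_add)
  qed
  then show "\<forall>\<^sub>F n in filtermap (\<lambda>n. n + i) \<omega>.
      real (card (A \<inter> {1..nat \<lfloor>2 powr (t - real i + real n)\<rfloor>})) / 2 powr (t - real i + real n)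
      \<le> 2 powr ((t' - real j) - (t - real i)) *
        (real (card (A \<inter> {1..nat \<lfloor>2 powr (t' - real j + real n)\<rfloor>})) / 2 powr (t' - real j + real n))"
    by simp
qed

lemma not_singular_if_same_orbit:
  assumes \<omega>: "\<omega> \<in> Nstar" and \<omega>': "\<omega>' \<in> Nstar" and t: "t \<in> {0..1}" and t': "t' \<in> {0..1}"
    and orb: "\<omega>' \<in> orbit \<omega>"
  shows "\<not> mutually_singular (nu (Omega_point \<omega> t)) (nu (Omega_point \<omega>' t'))"
proof -
  obtain i j where eq: "filtermap (\<lambda>n. n + i) \<omega> = filtermap (\<lambda>n. n + j) \<omega>'"
    using orb \<omega> \<omega>' by (auto simp: orbit_iff tau_funpow_eq)
  note nu_eq = nu_Omega_point[OF \<omega> t] nu_Omega_point[OF \<omega>' t']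
  note prob = fin_additive_prob_nu[OF \<omega> t] fin_additive_prob_nu[OF \<omega>' t']
  show ?thesis
  proof (cases "t - real i \<le> t' - real j")
    case True
    show ?thesis
      by (rule not_mutually_singular_if_dominated[OF prob(1), of "2 powr ((t' - j) - (t - i))"])
        (use nu_rep_dominated[OF \<omega> \<omega>' eq True] in \<open>simp_all add: nu_eq\<close>)
  next
    case False
    then have le: "t' - real j \<le> t - real i" by simp
    have "\<not> mutually_singular (nu (Omega_point \<omega>' t')) (nu (Omega_point \<omega> t))"
      by (rule not_mutually_singular_if_dominated[OF prob(2), of "2 powr ((t - i) - (t' - j))"])
        (use nu_rep_dominated[OF \<omega>' \<omega> eq[symmetric] le] in \<open>simp_all add: nu_eq\<close>)
    then show ?thesis using mutually_singular_commute by blast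
  qed
qed

section \<open>Separating distinct orbits\<close>

lemma ultrafilters_separate:
  assumes F: "F \<in> ultrafilters" and G: "G \<in> ultrafilters" and "F \<noteq> G"
  obtains A where "eventually (\<lambda>n. n \<in> A) F" "eventually (\<lambda>n. n \<notin> A) G"
proof -
  obtain A where "eventually (\<lambda>n. n \<in> A) F" "\<not> eventually (\<lambda>n. n \<in> A) G"
    using ultrafilters_eqI[OF F G] \<open>F \<noteq> G\<close> by blast
  then show thesis using that ultrafilters_dichotomy[OF G] by blast
qed

lemma distinct_orbits_separate:
  assumes \<omega>: "\<omega> \<in> Nstar" and \<omega>': "\<omega>' \<in> Nstar" and orb: "\<omega>' \<notin> orbit \<omega>"
  obtains B B' where "eventually (\<lambda>n. n \<in> B) \<omega>" "eventually (\<lambda>n. n \<in> B') \<omega>'"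
    "\<And>b b'. b \<in> B \<Longrightarrow> b' \<in> B' \<Longrightarrow> b + m < b' \<or> b' + m < b"
proof -
  \<comment> \<open>Shifting \<open>\<omega>\<close> by \<open>m\<close> turns the relative shifts
    -m, ..., m into natural numbers \<open>j\<close> from 0 to 2m. As these are finitely many, the
    sets separating the shifted ultrafilters can be intersected.\<close>
  have "\<exists>A. eventually (\<lambda>n. n + m \<in> A) \<omega> \<and> eventually (\<lambda>n. n + j \<notin> A) \<omega>'" for j
  proof -
    have "(tau ^^ m) \<omega> \<in> ultrafilters" "(tau ^^ j) \<omega>' \<in> ultrafilters"
      using tau_funpow_Nstar \<omega> \<omega>' Nstar_subset by blast+
    moreover have "(tau ^^ m) \<omega> \<noteq> (tau ^^ j) \<omega>'"
      using orb \<omega> \<omega>' by (auto simp: orbit_iff)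
    ultimately obtain A where "eventually (\<lambda>n. n \<in> A) ((tau ^^ m) \<omega>)"
      "eventually (\<lambda>n. n \<notin> A) ((tau ^^ j) \<omega>')"
      using ultrafilters_separate by blast
    then show ?thesis using \<omega> \<omega>' by (auto simp: tau_funpow_eq eventually_filtermap)
  qed
  then obtain A where A: "\<And>j. eventually (\<lambda>n. n + m \<in> A j) \<omega>"
    "\<And>j. eventually (\<lambda>n. n + j \<notin> A j) \<omega>'" by metis
  show thesis
  proof
    show "eventually (\<lambda>n. n \<in> {n. \<forall>j\<in>{..2 * m}. n + m \<in> A j}) \<omega>"
      unfolding mem_Collect_eq using A(1) by (intro eventually_ball_finite) auto
    show "eventually (\<lambda>n. n \<in> {n. \<forall>j\<in>{..2 * m}. n + j \<notin> A j}) \<omega>'"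
      unfolding mem_Collect_eq using A(2) by (intro eventually_ball_finite) auto
    fix b b' assume b: "b \<in> {n. \<forall>j\<in>{..2 * m}. n + m \<in> A j}" "b' \<in> {n. \<forall>j\<in>{..2 * m}. n + j \<notin> A j}"
    show "b + m < b' \<or> b' + m < b"
    proof (rule ccontr)
      assume "\<not> (b + m < b' \<or> b' + m < b)"
      \<comment> \<open>For \<open>j = b + m - b'\<close>, where the subtraction does not truncate,
        the number \<open>b + m = b' + j\<close> would lie both in \<open>A j\<close> and outside
        it.\<close>
      then have "b + m - b' \<in> {..2 * m}" "b' + (b + m - b') = b + m" by auto
      then show False using b by (metis (mono_tags, lifting) mem_Collect_eq)
    qed
  qed
qed

text \<open>For \<open>n\<close> in \<open>B\<close> and window length x, hypothesis
  \<open>le\<close> keeps \<open>A\<close> out of (c x, x], so at most c x points are counted.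
  Values of \<open>n\<close> outside \<open>B\<close> do not affect the limit along
  \<open>\<omega>\<close>.\<close>

lemma nu_rep_le:
  assumes \<omega>: "\<omega> \<in> Nstar" and B: "eventually (\<lambda>n. n \<in> B) \<omega>" and c: "c \<ge> 0"
    and le: "\<And>n k. n \<in> B \<Longrightarrow> k \<in> A \<Longrightarrow> real k \<le> 2 powr t * 2 ^ n \<Longrightarrow> real k \<le> c * (2 powr t * 2 ^ n)"
    and A: "A \<subseteq> Npos"
  shows "nu_rep \<omega> t A \<le> c"
proof (rule tendsto_upperbound[OF nu_rep_tendsto[OF \<omega>]])
  show "\<omega> \<noteq> bot" using \<omega> by (simp add: Nstar_iff ultrafilters_def)
  show "\<forall>\<^sub>F n in \<omega>. real (card (A \<inter> {1..nat \<lfloor>2 powr t * 2 ^ n\<rfloor>})) / (2 powr t * 2 ^ n) \<le> c"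
    using B
  proof eventually_elim
    case (elim n)
    let ?x = "2 powr t * 2 ^ n"
    have "k \<le> nat \<lfloor>c * ?x\<rfloor>" if "k \<in> A" "k \<le> nat \<lfloor>?x\<rfloor>" for k
    proof -
      have "real k \<le> ?x" using that(2) by (simp add: le_nat_floor le_nat_iff le_floor_iff)
      then show ?thesis using le[OF elim that(1)] by (intro le_nat_floor)
    qed
    then have "card (A \<inter> {1..nat \<lfloor>?x\<rfloor>}) \<le> card {1..nat \<lfloor>c * ?x\<rfloor>}"
      by (intro card_mono) auto
    then have "real (card (A \<inter> {1..nat \<lfloor>?x\<rfloor>})) \<le> real (nat \<lfloor>c * ?x\<rfloor>)" by simp
    also have "\<dots> \<le> c * ?x" using c by (intro of_nat_floor) simp
    finally show ?case by (simp add: divide_le_eq)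
  qed
qed

section \<open>Construction of the separating set\<close>

lemma singular_if_distinct_orbits:
  assumes \<omega>: "\<omega> \<in> Nstar" and \<omega>': "\<omega>' \<in> Nstar" and t: "t \<in> {0..1}" and t': "t' \<in> {0..1}"
    and orb: "\<omega>' \<notin> orbit \<omega>"
  shows "mutually_singular (nu (Omega_point \<omega> t)) (nu (Omega_point \<omega>' t'))"
  unfolding mutually_singular_def
proof (intro allI impI)
  fix \<epsilon> :: real assume "\<epsilon> > 0"
  then obtain m where m: "(1 / 2) ^ m < \<epsilon>"
    using real_arch_pow_inv[of \<epsilon> "1 / 2"] by auto
  obtain B B' where B: "eventually (\<lambda>n. n \<in> B) \<omega>" and B': "eventually (\<lambda>n. n \<in> B') \<omega>'"
    and sep: "\<And>b b'. b \<in> B \<Longrightarrow> b' \<in> B' \<Longrightarrow> b + m < b' \<or> b' + m < b"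
    using distinct_orbits_separate[OF \<omega> \<omega>' orb, of m] by blast
  let ?\<theta> = "2 powr t" and ?\<theta>' = "2 powr t'"
  have \<theta>: "1 \<le> ?\<theta>" "?\<theta> \<le> 2" "1 \<le> ?\<theta>'" "?\<theta>' \<le> 2"
    using t t' powr_mono[of _ 1 "2::real"] by (auto simp: ge_one_powr_ge_zero)
  \<comment> \<open>The measure of \<open>\<omega>\<close> concentrates on \<open>E\<close>, so the
    witness \<open>D\<close> is \<open>Npos - E\<close>. The factor \<open>(1 / 2) ^ m\<close> keeps
    the lower endpoint correct when b < m.\<close>
  define E where "E = {k \<in> Npos. \<exists>b\<in>B. (1 / 2) ^ m * (?\<theta> * 2 ^ b) < real k \<and> real k \<le> ?\<theta> * 2 ^ b}"
  \<comment> \<open>For \<open>n\<close> in \<open>B\<close> the block with \<open>b = n\<close>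
    fills the top of the window, so points outside \<open>E\<close> lie in its lowest fraction
    2^(-m).\<close>
  have "nu_rep \<omega> t (Npos - E) \<le> (1 / 2) ^ m"
    by (rule nu_rep_le[OF \<omega> B]) (force simp: E_def)+
  moreover have "nu_rep \<omega>' t' E \<le> (1 / 2) ^ m"
  proof (rule nu_rep_le[OF \<omega>' B'])
    fix n k assume n: "n \<in> B'" and k: "k \<in> E" and kn: "real k \<le> ?\<theta>' * 2 ^ n"
    from k obtain b where b: "b \<in> B" "(1 / 2) ^ m * (?\<theta> * 2 ^ b) < real k" "real k \<le> ?\<theta> * 2 ^ b"
      by (auto simp: E_def)
    show "real k \<le> (1 / 2) ^ m * (?\<theta>' * 2 ^ n)"
      using sep[OF b(1) n]
    proof
      \<comment> \<open>The block ends within the lowest fraction 2^(-m) of the window. The strict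
        gap supplies a factor 2, which absorbs \<open>?\<theta> \<le> 2\<close>.\<close>
      assume "b + m < n"
      then have "(2::real) ^ (Suc b + m) \<le> 2 ^ n" by (intro power_increasing) auto
      then have "2 * 2 ^ b \<le> (1 / 2) ^ m * (2 ^ n :: real)"
        by (simp add: power_add field_simps)
      moreover have "?\<theta> * 2 ^ b \<le> 2 * 2 ^ b" using \<theta> by (intro mult_right_mono) auto
      moreover have "(1 / 2) ^ m * (1 * 2 ^ n) \<le> (1 / 2) ^ m * (?\<theta>' * 2 ^ n)"
        using \<theta> by (intro mult_left_mono mult_right_mono) auto
      ultimately show ?thesis using b(3) by linarith
    next
      \<comment> \<open>The window ends before the block begins, so no such \<open>k\<close> exists;
        the spare factor 2 now absorbs \<open>?\<theta>'\<close>.\<close>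
      assume "n + m < b"
      then have "(2::real) ^ (Suc n + m) \<le> 2 ^ b" by (intro power_increasing) auto
      then have "2 * 2 ^ n \<le> (1 / 2) ^ m * (2 ^ b :: real)"
        by (simp add: power_add field_simps)
      moreover have "?\<theta>' * 2 ^ n \<le> 2 * 2 ^ n" using \<theta> by (intro mult_right_mono) auto
      moreover have "(1 / 2) ^ m * (1 * 2 ^ b) \<le> (1 / 2) ^ m * (?\<theta> * 2 ^ b)"
        using \<theta> by (intro mult_left_mono mult_right_mono) auto
      ultimately show ?thesis using b(2) kn by linarith
    qed
  qed (auto simp: E_def)
  moreover have "Npos - (Npos - E) = E" by (auto simp: E_def)
  ultimately show "\<exists>D\<subseteq>Npos. nu (Omega_point \<omega> t) D < \<epsilon> \<and> nu (Omega_point \<omega>' t') (Npos - D) < \<epsilon>"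
    using m by (intro exI[of _ "Npos - E"]) (simp add: nu_Omega_point[OF \<omega> t] nu_Omega_point[OF \<omega>' t'])
qed

theorem theorem3p6:
  fixes \<omega> \<omega>' :: "nat filter" and t t' :: real
  assumes "\<omega> \<in> Nstar" and "\<omega>' \<in> Nstar"
    and "t \<in> {0..1}" and "t' \<in> {0..1}"
  shows "(mutually_singular (nu (Omega_point \<omega> t)) (nu (Omega_point \<omega>' t'))
            \<longleftrightarrow> orbit \<omega> \<inter> orbit \<omega>' = {})
       \<and> (orbit \<omega> \<inter> orbit \<omega>' = {} \<longleftrightarrow> \<omega>' \<notin> orbit \<omega>)"
  using orbits_disjoint_iff[OF assms(1,2)] not_singular_if_same_orbit[OF assms]
    singular_if_distinct_orbits[OF assms] by blast

end
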